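(* Let $\Gamma=(G,\sigma)$ be a signed graph. The following are equivalent: (1) $\Gamma$ is sign-symmetric; (2) $\Gamma$ has a weak automorphism; (3) there exists $\varphi\in Aut(G)$ such that $\varphi(\mathcal{C}_1^+)=\mathcal{C}_1^-$ and $\varphi(\mathcal{C}_0^+)=\mathcal{C}_0^+$.
   Context: Graphs are finite and simple. A signed graph $\Gamma=(G,\sigma)$ consists of a connected simple graph $G$ and a function $\sigma:E(G)\to\{+1,-1\}$. Switching $\Gamma$ with respect to $U\subseteq V(G)$ means reversing the signs of all edges between $U$ and $V(G)\setminus U$. Two signed graphs are isomorphic if there is an isomorphism of the underlying graphs preserving edge signs; $\Gamma$ and $\Gamma'$ are switching isomorphic ($\Gamma\simeq\Gamma'$) if $\Gamma$ is isomorphic to a switching of $\Gamma'$. $-\Gamma=(G,-\sigma)$. $\Gamma$ is sign-symmetric if $\Gamma\simeq-\Gamma$. The sign of a cycle $C$ is $\sigma(C)=\prod_{e\in E(C)}\sigma(e)$. $\mathcal{C}_0$ (resp. $\mathcal{C}_1$) is the set of cycles of $G$ of even (resp. odd) length, and $\mathcal{C}_i^{+}$ (resp. $\mathcal{C}_i^-$) is the set of $C\in\mathcal{C}_i$ with $\sigma(C)=1$ (resp. $\sigma(C)=-1$). $Aut(G)$ is the automorphism group of the (unsigned) graph $G$, acting on cycles of $G$. A weak automorphism of $\Gamma$ is a $\varphi\in Aut(G)$ with $\sigma(\varphi(C))=-\sigma(C)$ for every $C\in\mathcal{C}_1$ and $\sigma(\varphi(C))=\sigma(C)$ for every $C\in\mathcal{C}_0$.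 *)

theory Defs
  imports Main
begin

record 'a graph =
  verts :: "'a set"
  edges :: "'a set set"

record 'a sgraph = "'a graph" +
  sign :: "'a set \<Rightarrow> int"

definition simple_graph :: "('a, 'b) graph_scheme \<Rightarrow> bool" where
  "simple_graph G \<longleftrightarrow>
     finite (verts G) \<and>
     (\<forall>e\<in>edges G. \<exists>u\<in>verts G. \<exists>v\<in>verts G. u \<noteq> v \<and> e = {u, v})"

definition connected_graph :: "('a, 'b) graph_scheme \<Rightarrow> bool" where
  "connected_graph G \<longleftrightarrow>
     (\<forall>u\<in>verts G. \<forall>v\<in>verts G. (u, v) \<in> {(x, y). {x, y} \<in> edges G}\<^sup>*)"

(* The values of the sign function on non-edges are irrelevant throughout. *)
definition signed_graph :: "'a sgraph \<Rightarrow> bool" where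
  "signed_graph \<Gamma> \<longleftrightarrow>
     simple_graph \<Gamma> \<and> connected_graph \<Gamma> \<and> (\<forall>e\<in>edges \<Gamma>. sign \<Gamma> e \<in> {1, -1})"

definition graph_iso ::
  "('a \<Rightarrow> 'c) \<Rightarrow> ('a, 'b) graph_scheme \<Rightarrow> ('c, 'd) graph_scheme \<Rightarrow> bool" where
  "graph_iso f G H \<longleftrightarrow>
     bij_betw f (verts G) (verts H) \<and>
     (\<forall>u\<in>verts G. \<forall>v\<in>verts G. {u, v} \<in> edges G \<longleftrightarrow> {f u, f v} \<in> edges H)"

(* Only the restriction of an automorphism to the vertex set is meaningful. *)
definition Aut :: "('a, 'b) graph_scheme \<Rightarrow> ('a \<Rightarrow> 'a) set" where
  "Aut G = {f. graph_iso f G G}"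

definition signed_graph_iso :: "('a \<Rightarrow> 'b) \<Rightarrow> 'a sgraph \<Rightarrow> 'b sgraph \<Rightarrow> bool" where
  "signed_graph_iso f \<Gamma> \<Delta> \<longleftrightarrow>
     graph_iso f \<Gamma> \<Delta> \<and> (\<forall>e\<in>edges \<Gamma>. sign \<Delta> (f ` e) = sign \<Gamma> e)"

definition switching :: "'a set \<Rightarrow> 'a sgraph \<Rightarrow> 'a sgraph" where
  "switching U \<Gamma> = \<Gamma>\<lparr>sign := \<lambda>e.
     if \<exists>u\<in>U. \<exists>v\<in>verts \<Gamma> - U. e = {u, v} then - sign \<Gamma> e else sign \<Gamma> e\<rparr>"

definition switching_isomorphic :: "'a sgraph \<Rightarrow> 'b sgraph \<Rightarrow> bool" where
  "switching_isomorphic \<Gamma> \<Delta> \<longleftrightarrow>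
     (\<exists>U f. U \<subseteq> verts \<Delta> \<and> signed_graph_iso f \<Gamma> (switching U \<Delta>))"

definition negation :: "'a sgraph \<Rightarrow> 'a sgraph" where
  "negation \<Gamma> = \<Gamma>\<lparr>sign := \<lambda>e. - sign \<Gamma> e\<rparr>"

definition sign_symmetric :: "'a sgraph \<Rightarrow> bool" where
  "sign_symmetric \<Gamma> \<longleftrightarrow> switching_isomorphic \<Gamma> (negation \<Gamma>)"

(* A cycle is a subgraph without isolated vertices, so it is represented by its
   edge set; its length is the number of its edges (see card_cycle_edges). *)
definition cycle_edges :: "'a list \<Rightarrow> 'a set set" where
  "cycle_edges vs = {{vs ! i, vs ! (Suc i mod length vs)} | i. i < length vs}"

definition cycles :: "('a, 'b) graph_scheme \<Rightarrow> 'a set set set" where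
  "cycles G = {cycle_edges vs | vs. 3 \<le> length vs \<and> distinct vs \<and> cycle_edges vs \<subseteq> edges G}"

lemma card_cycle_edges:
  assumes "3 \<le> length vs" and "distinct vs"
  shows "card (cycle_edges vs) = length vs"
proof -
  let ?n = "length vs"
  have suc: "Suc k mod ?n = (if Suc k = ?n then 0 else Suc k)" if "k < ?n" for k
    using that by auto
  have "inj_on (\<lambda>i. {vs ! i, vs ! (Suc i mod ?n)}) {..<?n}"
  proof (rule inj_onI)
    fix i j
    assume i: "i \<in> {..<?n}" and j: "j \<in> {..<?n}"
      and eq: "{vs ! i, vs ! (Suc i mod ?n)} = {vs ! j, vs ! (Suc j mod ?n)}"
    have lt: "i < ?n" "j < ?n" "Suc i mod ?n < ?n" "Suc j mod ?n < ?n"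
      using i j by (auto intro: mod_less_divisor)
    from eq have "i = j \<or> i = Suc j mod ?n \<and> Suc i mod ?n = j"
      using lt by (simp add: doubleton_eq_iff nth_eq_iff_index_eq[OF assms(2)]) blast
    then show "i = j"
      using suc[OF lt(1)] suc[OF lt(2)] assms(1) by (auto split: if_splits)
  qed
  moreover have "cycle_edges vs = (\<lambda>i. {vs ! i, vs ! (Suc i mod ?n)}) ` {..<?n}"
    unfolding cycle_edges_def by auto
  ultimately show ?thesis
    by (simp add: card_image)
qed

definition even_cycles :: "('a, 'b) graph_scheme \<Rightarrow> 'a set set set" where
  "even_cycles G = {C \<in> cycles G. even (card C)}"

definition odd_cycles :: "('a, 'b) graph_scheme \<Rightarrow> 'a set set set" where
  "odd_cycles G = {C \<in> cycles G. odd (card C)}"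

definition cycle_sign :: "'a sgraph \<Rightarrow> 'a set set \<Rightarrow> int" where
  "cycle_sign \<Gamma> C = (\<Prod>e\<in>C. sign \<Gamma> e)"

definition pos_even_cycles :: "'a sgraph \<Rightarrow> 'a set set set" where
  "pos_even_cycles \<Gamma> = {C \<in> even_cycles \<Gamma>. cycle_sign \<Gamma> C = 1}"

definition pos_odd_cycles :: "'a sgraph \<Rightarrow> 'a set set set" where
  "pos_odd_cycles \<Gamma> = {C \<in> odd_cycles \<Gamma>. cycle_sign \<Gamma> C = 1}"

definition neg_odd_cycles :: "'a sgraph \<Rightarrow> 'a set set set" where
  "neg_odd_cycles \<Gamma> = {C \<in> odd_cycles \<Gamma>. cycle_sign \<Gamma> C = -1}"

definition map_cycle :: "('a \<Rightarrow> 'b) \<Rightarrow> 'a set set \<Rightarrow> 'b set set" where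
  "map_cycle f C = (\<lambda>e. f ` e) ` C"

definition weak_automorphism :: "'a sgraph \<Rightarrow> ('a \<Rightarrow> 'a) \<Rightarrow> bool" where
  "weak_automorphism \<Gamma> \<phi> \<longleftrightarrow>
     \<phi> \<in> Aut \<Gamma> \<and>
     (\<forall>C\<in>odd_cycles \<Gamma>. cycle_sign \<Gamma> (map_cycle \<phi> C) = - cycle_sign \<Gamma> C) \<and>
     (\<forall>C\<in>even_cycles \<Gamma>. cycle_sign \<Gamma> (map_cycle \<phi> C) = cycle_sign \<Gamma> C)"

end

theory Submission
  imports Defs
begin

text \<open>
  For an automorphism \<open>\<phi>\<close>, put \<open>\<tau> e = - \<sigma> e * \<sigma> (\<phi> e)\<close>. That \<open>\<phi>\<close> is a weak automorphism says that
  \<open>\<tau>\<close> has product \<open>1\<close> on every cycle, and that \<open>\<phi>\<close> is an isomorphism from \<open>\<Gamma>\<close> onto a switching of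
  \<open>-\<Gamma>\<close> says that \<open>\<tau>\<close> is the sign function of a cut. These conditions agree by Harary's balance
  theorem. The third condition is a weak automorphism seen through the permutations that \<open>\<phi>\<close>
  induces on the finite sets of odd and of even cycles.
\<close>

section \<open>Signs of walks\<close>

fun walk_sign :: "('a set \<Rightarrow> int) \<Rightarrow> 'a list \<Rightarrow> int" where
  "walk_sign \<tau> (x # y # xs) = \<tau> {x, y} * walk_sign \<tau> (y # xs)"
| "walk_sign \<tau> _ = 1"

abbreviation walk :: "'a set set \<Rightarrow> 'a list \<Rightarrow> bool" where
  "walk E \<equiv> successively (\<lambda>x y. {x, y} \<in> E)"

text \<open>The vertex \<open>x\<close> ends the first piece and starts the second, so every step of
  the walk is counted in exactly one of them.\<close>

lemma walk_sign_append:
  "walk_sign \<tau> (xs @ x # ys) = walk_sign \<tau> (xs @ [x]) * walk_sign \<tau> (x # ys)"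
  by (induction \<tau> xs rule: walk_sign.induct) (cases ys; simp)+

lemma walk_sign_rev: "walk_sign \<tau> (rev xs) = walk_sign \<tau> xs"
proof (induction \<tau> xs rule: walk_sign.induct)
  case (1 \<tau> x y xs)
  have "walk_sign \<tau> (rev (x # y # xs)) = walk_sign \<tau> (rev (y # xs)) * \<tau> {y, x}"
    using walk_sign_append[of \<tau> "rev xs" y "[x]"] by simp
  then show ?case
    using 1 by (simp add: insert_commute)
qed simp_all

lemma walk_append:
  "walk E (xs @ x # ys) \<longleftrightarrow> walk E (xs @ [x]) \<and> walk E (x # ys)"
  by (auto simp: successively_append_iff)

lemma walk_rev: "walk E (rev xs) \<longleftrightarrow> walk E xs"
  by (simp add: insert_commute)

text \<open>Indexing by positions counts an edge as often as it is traversed. For the empty list the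
  truncated subtraction yields an empty product, in line with the default value 1.\<close>

lemma walk_sign_eq_prod:
  "walk_sign \<tau> xs = (\<Prod>i<length xs - 1. \<tau> {xs ! i, xs ! Suc i})"
  by (induction \<tau> xs rule: walk_sign.induct) (simp_all add: prod.lessThan_Suc_shift del: prod.lessThan_Suc)

lemma walk_sign_pm1:
  assumes "\<And>e. e \<in> E \<Longrightarrow> \<tau> e \<in> {1, -1}" and "walk E xs"
  shows "walk_sign \<tau> xs \<in> {1, -1}"
  using assms(2)
proof (induction xs rule: induct_list012)
  case (3 x y zs)
  then show ?case
    using assms(1)[of "{x, y}"] by auto
qed simp_all

section \<open>Cycles as closed walks\<close>

lemma cycle_edges_eq_image:
  "cycle_edges vs = (\<lambda>i. {vs ! i, vs ! (Suc i mod length vs)}) ` {..<length vs}"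
  unfolding cycle_edges_def by auto

text \<open>Repeating the first vertex at the end turns the cyclic successor into the ordinary one;
  only the last position wraps around.\<close>

lemma nth_closed_walk:
  assumes "i < length vs"
  shows "(vs @ [hd vs]) ! i = vs ! i"
    and "(vs @ [hd vs]) ! Suc i = vs ! (Suc i mod length vs)"
proof -
  show "(vs @ [hd vs]) ! i = vs ! i"
    using assms by (simp add: nth_append)
  show "(vs @ [hd vs]) ! Suc i = vs ! (Suc i mod length vs)"
  proof (cases "Suc i = length vs")
    case True
    then have "vs \<noteq> []" by auto
    with True show ?thesis
      by (simp add: nth_append hd_conv_nth)
  next
    case False
    with assms show ?thesis
      by (simp add: nth_append)
  qed
qed

text \<open>An edge set forgets multiplicities while a walk counts every step; the two products
  agree because different positions carry different edges.\<close>

lemma prod_cycle_edges: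
  assumes "3 \<le> length vs" and "distinct vs"
  shows "(\<Prod>e\<in>cycle_edges vs. \<tau> e) = walk_sign \<tau> (vs @ [hd vs])"
proof -
  let ?f = "\<lambda>i. {vs ! i, vs ! (Suc i mod length vs)}"
  \<comment> \<open>There are as many edges as positions, which forces the indexing to be
    injective.\<close>
  have "inj_on ?f {..<length vs}"
    using card_cycle_edges[OF assms]
    by (intro eq_card_imp_inj_on) (simp_all add: cycle_edges_eq_image)
  then have "(\<Prod>e\<in>cycle_edges vs. \<tau> e) = (\<Prod>i<length vs. \<tau> (?f i))"
    by (simp add: cycle_edges_eq_image prod.reindex)
  also have "\<dots> = walk_sign \<tau> (vs @ [hd vs])"
    by (simp add: walk_sign_eq_prod nth_closed_walk)
  finally show ?thesis .
qed

lemma walk_cycle_edges: "walk E (vs @ [hd vs]) \<longleftrightarrow> cycle_edges vs \<subseteq> E"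
  by (auto simp: successively_conv_nth nth_closed_walk cycle_edges_eq_image)

text \<open>Induction on length: at a repeated vertex the walk falls apart into two shorter closed
  walks. Without repetition it is a loop, which is excluded, an edge traversed back and forth, or a
  cycle.\<close>

lemma closed_walk_sign:
  assumes loopless: "\<And>x. {x} \<notin> E"
    and pm1: "\<And>e. e \<in> E \<Longrightarrow> \<tau> e \<in> {1, -1}"
    and cycle: "\<And>vs. \<lbrakk>3 \<le> length vs; distinct vs; cycle_edges vs \<subseteq> E\<rbrakk>
      \<Longrightarrow> (\<Prod>e\<in>cycle_edges vs. \<tau> e) = 1"
    and "walk E (x # xs @ [x])"
  shows "walk_sign \<tau> (x # xs @ [x]) = 1"
  using assms(4)
proof (induction "length xs" arbitrary: x xs rule: less_induct)
  case less
  show ?case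
  proof (cases "distinct (x # xs)")
    case True
    consider "xs = []" | y where "xs = [y]" | "3 \<le> length (x # xs)"
      by (cases xs; cases "tl xs") auto
    then show ?thesis
    proof cases
      case 1
      with less.prems loopless show ?thesis by simp
    next
      \<comment> \<open>The edge \<open>{x, y}\<close> is traversed twice and contributes the square
        of a sign.\<close>
      case (2 y)
      with less.prems pm1[of "{x, y}"] show ?thesis
        by (auto simp: insert_commute)
    next
      case 3
      with less.prems True cycle[of "x # xs"] prod_cycle_edges[of "x # xs" \<tau>]
        walk_cycle_edges[of E "x # xs"]
      show ?thesis by simp
    qed
  next
    case False
    show ?thesis
    proof (cases "x \<in> set xs")
      case True
      then obtain ys zs where xs: "xs = ys @ x # zs"
        by (meson split_list)
      then have "walk E (x # ys @ [x])" "walk E (x # zs @ [x])"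
        using less.prems walk_append[of E "x # ys" x "zs @ [x]"] by simp_all
      then have "walk_sign \<tau> (x # ys @ [x]) = 1" "walk_sign \<tau> (x # zs @ [x]) = 1"
        using less.hyps xs by simp_all
      then show ?thesis
        using walk_sign_append[of \<tau> "x # ys" x "zs @ [x]"] xs by simp
    next
      case x: False
      with False have "\<not> distinct xs" by simp
      \<comment> \<open>The repetition avoids the base point, so the loop at \<open>y\<close> is cut
        out. Both the loop and the remaining closed walk at \<open>x\<close> are shorter than the
        original.\<close>
      then obtain as y bs cs where xs: "xs = as @ [y] @ bs @ [y] @ cs"
        using not_distinct_decomp by blast
      have w: "walk E (x # as @ [y])" "walk E (y # bs @ [y])" "walk E (y # cs @ [x])"
        using less.prems xs walk_append[of E "x # as" y "bs @ y # cs @ [x]"]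
          walk_append[of E "y # bs" y "cs @ [x]"] by simp_all
      then have "walk E (x # (as @ y # cs) @ [x])"
        using walk_append[of E "x # as" y "cs @ [x]"] by simp
      then have "walk_sign \<tau> (x # (as @ y # cs) @ [x]) = 1"
        using less.hyps[of "as @ y # cs" x] xs by simp
      moreover have "walk_sign \<tau> (y # bs @ [y]) = 1"
        using less.hyps[of bs y] w(2) xs by simp
      ultimately show ?thesis
        using walk_sign_append[of \<tau> "x # as" y "bs @ y # cs @ [x]"]
          walk_sign_append[of \<tau> "y # bs" y "cs @ [x]"]
          walk_sign_append[of \<tau> "x # as" y "cs @ [x]"] xs by simp
    qed
  qed
qed

section \<open>Cuts and Harary's balance theorem\<close>

lemma edge_ends_distinct:
  assumes "simple_graph G" and "{u, v} \<in> edges G"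
  shows "u \<in> verts G" "v \<in> verts G" "u \<noteq> v"
  using assms unfolding simple_graph_def by (fastforce simp: doubleton_eq_iff)+

lemma edgeE:
  assumes "simple_graph G" and "e \<in> edges G"
  obtains u v where "e = {u, v}" "u \<in> verts G" "v \<in> verts G" "u \<noteq> v"
  using assms unfolding simple_graph_def by blast

text \<open>On an edge this is the factor introduced by switching at \<open>U\<close>. A product
  over the ends needs no order on them and is carried along injective maps by reindexing.\<close>

definition cut_sign :: "'a set \<Rightarrow> 'a set \<Rightarrow> int" where
  "cut_sign U e = (\<Prod>x\<in>e. if x \<in> U then -1 else 1)"

lemma cut_sign_doubleton:
  "u \<noteq> v \<Longrightarrow> cut_sign U {u, v} = (if u \<in> U \<longleftrightarrow> v \<in> U then 1 else -1)"
  by (simp add: cut_sign_def)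

text \<open>Every -1 is a change of side, so only the sides of the two end vertices matter.\<close>

lemma walk_sign_cut:
  assumes "\<And>x. {x} \<notin> E" and "walk E xs" and "xs \<noteq> []"
  shows "walk_sign (cut_sign U) xs = (if hd xs \<in> U \<longleftrightarrow> last xs \<in> U then 1 else -1)"
  using assms(2,3)
proof (induction xs rule: induct_list012)
  case (3 x y zs)
  then have "x \<noteq> y"
    using assms(1) by auto
  with 3 show ?case
    by (auto simp: cut_sign_doubleton)
qed simp_all

lemma ex_walk:
  assumes "connected_graph G" and "u \<in> verts G" and "v \<in> verts G"
  obtains xs where "walk (edges G) xs" "xs \<noteq> []" "hd xs = u" "last xs = v"
proof -
  have "(u, v) \<in> {(x, y). {x, y} \<in> edges G}\<^sup>*"
    using assms unfolding connected_graph_def by blast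
  then have "\<exists>xs. walk (edges G) xs \<and> xs \<noteq> [] \<and> hd xs = u \<and> last xs = v"
  proof (induction rule: rtrancl_induct)
    case base
    show ?case by (rule exI[of _ "[u]"]) simp
  next
    case (step y z)
    then obtain xs where "walk (edges G) xs" "xs \<noteq> []" "hd xs = u" "last xs = y" by blast
    with step(2) show ?case
      by (intro exI[of _ "xs @ [z]"]) (simp add: successively_append_iff)
  qed
  then show thesis using that by blast
qed

text \<open>The sign of a walk from a fixed root serves as a potential on the vertices, and
  \<open>\<tau>\<close> is recovered from it because closed walks have sign 1.\<close>

lemma balanced_imp_cut:
  assumes simple: "simple_graph G" and conn: "connected_graph G"
    and pm1: "\<And>e. e \<in> edges G \<Longrightarrow> \<tau> e \<in> {1, -1}"
    and balanced: "\<forall>C\<in>cycles G. (\<Prod>e\<in>C. \<tau> e) = 1"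
  shows "\<exists>U\<subseteq>verts G. \<forall>e\<in>edges G. \<tau> e = cut_sign U e"
proof (cases "verts G = {}")
  \<comment> \<open>The empty graph counts as connected and offers no root, but it has no edges
    either.\<close>
  case True
  with simple show ?thesis
    unfolding simple_graph_def by auto
next
  case False
  then obtain r where r: "r \<in> verts G" by blast
  let ?W = "\<lambda>v xs. walk (edges G) xs \<and> xs \<noteq> [] \<and> hd xs = r \<and> last xs = v"
  define w where "w v = (SOME xs. ?W v xs)" for v
  have w: "?W v (w v)" if v: "v \<in> verts G" for v
  proof -
    obtain xs where "?W v xs" using ex_walk[OF conn r v] by blast
    then show ?thesis unfolding w_def by (rule someI)
  qed
  define U where "U = {v \<in> verts G. walk_sign \<tau> (w v) = -1}"
  have "\<tau> e = cut_sign U e" if e: "e \<in> edges G" for e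
  proof -
    obtain u v where uv: "e = {u, v}" "u \<in> verts G" "v \<in> verts G" "u \<noteq> v"
      using edgeE[OF simple e] .
    have signs: "walk_sign \<tau> (w u) \<in> {1, -1}" "walk_sign \<tau> (w v) \<in> {1, -1}"
      using walk_sign_pm1[of "edges G" \<tau>, OF pm1] w[OF uv(2)] w[OF uv(3)] by simp_all
    obtain as where as: "w u = as @ [u]"
      using w[OF uv(2)] by (metis append_butlast_last_id)
    obtain bs where bs: "w v = bs @ [v]"
      using w[OF uv(3)] by (metis append_butlast_last_id)
    \<comment> \<open>From the root to \<open>u\<close>, across the edge to \<open>v\<close>, and
      back to the root along the reversed walk.\<close>
    let ?c = "as @ u # v # rev bs"
    have rev_bs: "walk_sign \<tau> (v # rev bs) = walk_sign \<tau> (w v)" "walk (edges G) (v # rev bs)"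
      using walk_sign_rev[of \<tau> "w v"] walk_rev[of "edges G" "w v"] w[OF uv(3)] bs by simp_all
    have c: "walk_sign \<tau> ?c = walk_sign \<tau> (w u) * \<tau> e * walk_sign \<tau> (w v)"
      using walk_sign_append[of \<tau> as u "v # rev bs"] rev_bs(1) uv(1) as by simp
    have wc: "walk (edges G) ?c"
      using walk_append[of "edges G" as u "v # rev bs"] rev_bs(2) w[OF uv(2)] uv(1) e as
      by simp
    have "hd ?c = r"
      using w[OF uv(2)] as by (cases as) auto
    moreover have "last ?c = r"
      using w[OF uv(3)] bs by (cases bs) auto
    \<comment> \<open>The list contains at least the two entries \<open>u\<close> and
      \<open>v\<close>, so its head and its last entry occupy different positions even if
      \<open>as\<close> and \<open>bs\<close> are empty.\<close>
    moreover have "?c = hd ?c # butlast (tl ?c) @ [last ?c]"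
      by (cases as; cases bs) (simp_all add: butlast_append)
    ultimately obtain xs where xs: "?c = r # xs @ [r]"
      by metis
    have "walk_sign \<tau> ?c = 1"
      unfolding xs
    proof (rule closed_walk_sign)
      show "{x} \<notin> edges G" for x
        using edge_ends_distinct(3)[OF simple, of x x] by auto
      show "(\<Prod>e\<in>cycle_edges vs. \<tau> e) = 1"
        if "3 \<le> length vs" "distinct vs" "cycle_edges vs \<subseteq> edges G" for vs
        using balanced that unfolding cycles_def by blast
      show "walk (edges G) (r # xs @ [r])"
        using wc unfolding xs .
    qed (fact pm1)
    \<comment> \<open>Hence \<open>\<tau> e\<close> is the product of the signs of the two chosen
      walks, which is -1 exactly when one end of \<open>e\<close> lies in \<open>U\<close>.\<close>
    then show ?thesis
      using c signs pm1[OF e] uv by (auto simp: cut_sign_doubleton U_def)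
  qed
  then show ?thesis
    by (intro exI[of _ U]) (auto simp: U_def)
qed

text \<open>Harary's theorem for an arbitrary edge sign \<open>\<tau>\<close>. A cycle returns to
  the side of the cut on which it starts, so it crosses the cut an even number of times.\<close>

theorem balanced_iff_cut:
  assumes simple: "simple_graph G" and "connected_graph G"
    and "\<And>e. e \<in> edges G \<Longrightarrow> \<tau> e \<in> {1, -1}"
  shows "(\<forall>C\<in>cycles G. (\<Prod>e\<in>C. \<tau> e) = 1) \<longleftrightarrow>
    (\<exists>U\<subseteq>verts G. \<forall>e\<in>edges G. \<tau> e = cut_sign U e)"
proof
  assume "\<exists>U\<subseteq>verts G. \<forall>e\<in>edges G. \<tau> e = cut_sign U e"
  then obtain U where U: "\<And>e. e \<in> edges G \<Longrightarrow> \<tau> e = cut_sign U e" by blast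
  show "\<forall>C\<in>cycles G. (\<Prod>e\<in>C. \<tau> e) = 1"
  proof
    fix C assume "C \<in> cycles G"
    then obtain vs where vs: "C = cycle_edges vs" "3 \<le> length vs" "distinct vs" "C \<subseteq> edges G"
      unfolding cycles_def by blast
    have "{x} \<notin> edges G" for x
      using edge_ends_distinct(3)[OF simple, of x x] by auto
    moreover have "walk (edges G) (vs @ [hd vs])"
      using vs walk_cycle_edges by blast
    moreover have "hd (vs @ [hd vs]) = last (vs @ [hd vs])"
      using vs(2) by (cases vs) auto
    ultimately have "walk_sign (cut_sign U) (vs @ [hd vs]) = 1"
      using walk_sign_cut[of "edges G" "vs @ [hd vs]" U] by simp
    moreover have "(\<Prod>e\<in>C. \<tau> e) = (\<Prod>e\<in>C. cut_sign U e)"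
      using vs(4) U by (intro prod.cong) auto
    ultimately show "(\<Prod>e\<in>C. \<tau> e) = 1"
      using prod_cycle_edges[OF vs(2,3)] vs(1) by simp
  qed
qed (use balanced_imp_cut assms in blast)

section \<open>Automorphisms acting on edges and cycles\<close>

lemma Aut_inj: "f \<in> Aut G \<Longrightarrow> inj_on f (verts G)"
  by (simp add: Aut_def graph_iso_def bij_betw_def)

lemma Aut_verts: "f \<in> Aut G \<Longrightarrow> f ` verts G = verts G"
  by (simp add: Aut_def graph_iso_def bij_betw_def)

lemma Aut_edge:
  assumes "simple_graph G" and "f \<in> Aut G" and e: "e \<in> edges G"
  shows "f ` e \<in> edges G"
proof -
  obtain u v where "e = {u, v}" "u \<in> verts G" "v \<in> verts G"
    using edgeE[OF assms(1) e] .
  with assms(2) e show ?thesis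
    by (simp add: Aut_def graph_iso_def)
qed

lemma edges_subset_Pow: "simple_graph G \<Longrightarrow> edges G \<subseteq> Pow (verts G)"
  unfolding simple_graph_def by auto

lemma finite_edges: "simple_graph G \<Longrightarrow> finite (edges G)"
  using edges_subset_Pow by (rule finite_subset) (auto simp: simple_graph_def)

lemma Aut_inj_edges:
  assumes "simple_graph G" and "f \<in> Aut G"
  shows "inj_on ((`) f) (edges G)"
  using inj_on_image_Pow[OF Aut_inj[OF assms(2)]] edges_subset_Pow[OF assms(1)]
  by (rule inj_on_subset)

lemma cycles_subset_Pow: "cycles G \<subseteq> Pow (edges G)"
  unfolding cycles_def by blast

lemma map_cycle_cycle_edges: "map_cycle f (cycle_edges vs) = cycle_edges (map f vs)"
proof -
  have "Suc i mod length vs < length vs" if "i < length vs" for i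
    using that by (intro mod_less_divisor) auto
  then show ?thesis
    by (auto simp: map_cycle_def cycle_edges_eq_image image_image intro!: image_cong)
qed

lemma cycle_verts:
  assumes "simple_graph G" and "cycle_edges vs \<subseteq> edges G"
  shows "set vs \<subseteq> verts G"
proof
  fix x assume "x \<in> set vs"
  then obtain i where "i < length vs" "x = vs ! i"
    by (metis in_set_conv_nth)
  then have "{x, vs ! (Suc i mod length vs)} \<in> edges G"
    using assms(2) by (auto simp: cycle_edges_eq_image)
  then show "x \<in> verts G"
    by (rule edge_ends_distinct(1)[OF assms(1)])
qed

lemma card_map_cycle:
  assumes "simple_graph G" and "f \<in> Aut G" and "C \<in> cycles G"
  shows "card (map_cycle f C) = card C"
  unfolding map_cycle_def using assms cycles_subset_Pow
  by (intro card_image inj_on_subset[OF Aut_inj_edges]) auto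

lemma map_cycle_in_cycles:
  assumes "simple_graph G" and "f \<in> Aut G" and "C \<in> cycles G"
  shows "map_cycle f C \<in> cycles G"
proof -
  obtain vs where vs: "C = cycle_edges vs" "3 \<le> length vs" "distinct vs" "C \<subseteq> edges G"
    using assms(3) unfolding cycles_def by blast
  have "distinct (map f vs)"
    using vs cycle_verts[OF assms(1)] Aut_inj[OF assms(2)]
    by (auto simp: distinct_map intro: inj_on_subset)
  moreover have "map_cycle f C \<subseteq> edges G"
    using vs(4) Aut_edge[OF assms(1,2)] unfolding map_cycle_def by blast
  ultimately show ?thesis
    using vs(1,2) unfolding cycles_def map_cycle_cycle_edges
    by (auto intro!: exI[of _ "map f vs"] simp: map_cycle_cycle_edges)
qed

text \<open>A cycle is a set of sets of vertices, so injectivity is lifted through the image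
  operation twice.\<close>

lemma inj_on_map_cycle:
  assumes "simple_graph G" and "f \<in> Aut G"
  shows "inj_on (map_cycle f) (cycles G)"
proof -
  have "map_cycle f = (`) ((`) f)"
    by (auto simp: map_cycle_def fun_eq_iff)
  then show ?thesis
    using inj_on_subset[OF inj_on_image_Pow[OF Aut_inj_edges[OF assms]] cycles_subset_Pow]
    by simp
qed

text \<open>The action preserves length, hence parity, and an injective map of a finite set into
  itself is onto.\<close>

lemma map_cycle_bij:
  assumes "simple_graph G" and "f \<in> Aut G"
  shows "bij_betw (map_cycle f) (odd_cycles G) (odd_cycles G)"
    and "bij_betw (map_cycle f) (even_cycles G) (even_cycles G)"
proof -
  have fin: "finite (cycles G)"
    using finite_edges[OF assms(1)] by (intro finite_subset[OF cycles_subset_Pow]) simp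
  have bij: "bij_betw (map_cycle f) X X"
    if "X \<subseteq> cycles G" "map_cycle f ` X \<subseteq> X" for X
    using that fin inj_on_map_cycle[OF assms]
    by (metis bij_betw_def endo_inj_surj finite_subset inj_on_subset)
  show "bij_betw (map_cycle f) (odd_cycles G) (odd_cycles G)"
    using card_map_cycle[OF assms] map_cycle_in_cycles[OF assms]
    by (intro bij) (auto simp: odd_cycles_def)
  show "bij_betw (map_cycle f) (even_cycles G) (even_cycles G)"
    using card_map_cycle[OF assms] map_cycle_in_cycles[OF assms]
    by (intro bij) (auto simp: even_cycles_def)
qed

section \<open>Switching isomorphisms and weak automorphisms\<close>

lemma cycle_sign_pm1:
  assumes "signed_graph \<Gamma>" and "C \<in> cycles \<Gamma>"
  shows "cycle_sign \<Gamma> C \<in> {1, -1}"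
proof -
  have "(\<Prod>e\<in>C. sign \<Gamma> e) \<in> {1, -1}" if "C \<subseteq> edges \<Gamma>" for C
    using that assms(1)
    by (induction C rule: infinite_finite_induct) (auto simp: signed_graph_def)
  with assms(2) cycles_subset_Pow show ?thesis
    unfolding cycle_sign_def by blast
qed

lemma switching_negation_sign:
  assumes "simple_graph \<Gamma>" and "e \<in> edges \<Gamma>"
  shows "sign (switching U (negation \<Gamma>)) e = - cut_sign U e * sign \<Gamma> e"
proof -
  obtain u v where uv: "e = {u, v}" "u \<in> verts \<Gamma>" "v \<in> verts \<Gamma>" "u \<noteq> v"
    using edgeE[OF assms] .
  \<comment> \<open>Either end may play the role of \<open>x\<close>, so the condition used by
    \<open>switching\<close> is symmetric in \<open>u\<close> and \<open>v\<close>.\<close>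
  then have "(\<exists>x\<in>U. \<exists>y\<in>verts \<Gamma> - U. e = {x, y}) \<longleftrightarrow> (u \<in> U \<longleftrightarrow> v \<notin> U)"
    by (auto simp: doubleton_eq_iff)
  with uv(1,4) show ?thesis
    by (simp add: switching_def negation_def cut_sign_doubleton)
qed

lemma cut_sign_image:
  assumes "inj_on f V" and "e \<subseteq> V" and "U \<subseteq> V"
  shows "cut_sign (f ` U) (f ` e) = cut_sign U e"
proof -
  have "inj_on f e"
    using assms by (meson inj_on_subset)
  moreover have "f x \<in> f ` U \<longleftrightarrow> x \<in> U" if "x \<in> e" for x
    using assms that by (meson inj_on_image_mem_iff subsetD)
  ultimately show ?thesis
    by (simp add: cut_sign_def prod.reindex)
qed

text \<open>The equivalence holds for each map \<open>f\<close> separately, so the same map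
  witnesses both properties.\<close>

lemma switching_iso_iff_weak_automorphism:
  assumes sg: "signed_graph \<Gamma>"
  shows "(\<exists>U\<subseteq>verts \<Gamma>. signed_graph_iso f \<Gamma> (switching U (negation \<Gamma>))) \<longleftrightarrow>
    weak_automorphism \<Gamma> f"
proof (cases "f \<in> Aut \<Gamma>")
  case False
  then show ?thesis
    by (auto simp: weak_automorphism_def signed_graph_iso_def Aut_def graph_iso_def
        switching_def negation_def)
next
  case aut: True
  have simple: "simple_graph \<Gamma>" and conn: "connected_graph \<Gamma>"
    and pm1: "\<And>e. e \<in> edges \<Gamma> \<Longrightarrow> sign \<Gamma> e \<in> {1, -1}"
    using sg unfolding signed_graph_def by blast+
  \<comment> \<open>Signs are their own inverses, so this is the isomorphism condition solved for
    the cut sign.\<close>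
  define \<tau> where "\<tau> e = - sign \<Gamma> e * sign \<Gamma> (f ` e)" for e
  note edge = Aut_edge[OF simple aut]
  have \<tau>_pm1: "\<tau> e \<in> {1, -1}" if "e \<in> edges \<Gamma>" for e
    using pm1[OF that] pm1[OF edge[OF that]] by (auto simp: \<tau>_def)
  have iso: "signed_graph_iso f \<Gamma> (switching (f ` U) (negation \<Gamma>)) \<longleftrightarrow>
      (\<forall>e\<in>edges \<Gamma>. \<tau> e = cut_sign U e)" if U: "U \<subseteq> verts \<Gamma>" for U
  proof -
    have "sign (switching (f ` U) (negation \<Gamma>)) (f ` e) = sign \<Gamma> e \<longleftrightarrow> \<tau> e = cut_sign U e"
      if e: "e \<in> edges \<Gamma>" for e
    proof -
      have "cut_sign (f ` U) (f ` e) = cut_sign U e"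
        using cut_sign_image[OF Aut_inj[OF aut] _ U] e edges_subset_Pow[OF simple] by blast
      then have "sign (switching (f ` U) (negation \<Gamma>)) (f ` e) =
          - cut_sign U e * sign \<Gamma> (f ` e)"
        using switching_negation_sign[OF simple edge[OF e]] by metis
      moreover obtain u v where "e = {u, v}" "u \<noteq> v"
        using edgeE[OF simple e] .
      ultimately show ?thesis
        using pm1[OF e] pm1[OF edge[OF e]] by (auto simp: \<tau>_def cut_sign_doubleton)
    qed
    with aut show ?thesis
      by (simp add: signed_graph_iso_def Aut_def graph_iso_def switching_def negation_def)
  qed
  \<comment> \<open>Each edge of \<open>C\<close> contributes one minus sign from the negation. This
    is where the parity of the length enters.\<close>
  have prod: "(\<Prod>e\<in>C. \<tau> e) = (-1) ^ card C * cycle_sign \<Gamma> C * cycle_sign \<Gamma> (map_cycle f C)"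
    if C: "C \<in> cycles \<Gamma>" for C
  proof -
    have "inj_on ((`) f) C"
      using C cycles_subset_Pow by (intro inj_on_subset[OF Aut_inj_edges[OF simple aut]]) auto
    then have "cycle_sign \<Gamma> (map_cycle f C) = (\<Prod>e\<in>C. sign \<Gamma> (f ` e))"
      by (simp add: cycle_sign_def map_cycle_def prod.reindex)
    moreover have "(\<Prod>e\<in>C. \<tau> e) = (\<Prod>e\<in>C. (-1) * (sign \<Gamma> e * sign \<Gamma> (f ` e)))"
      by (simp add: \<tau>_def)
    ultimately show ?thesis
      by (simp only: prod.distrib prod_constant cycle_sign_def mult.assoc)
  qed
  have "(\<exists>U\<subseteq>verts \<Gamma>. signed_graph_iso f \<Gamma> (switching U (negation \<Gamma>))) \<longleftrightarrow>
      (\<exists>U\<subseteq>verts \<Gamma>. signed_graph_iso f \<Gamma> (switching (f ` U) (negation \<Gamma>)))"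
    using Aut_verts[OF aut] by (metis subset_image_iff)
  also have "\<dots> \<longleftrightarrow> (\<exists>U\<subseteq>verts \<Gamma>. \<forall>e\<in>edges \<Gamma>. \<tau> e = cut_sign U e)"
    using iso by blast
  also have "\<dots> \<longleftrightarrow> (\<forall>C\<in>cycles \<Gamma>. (\<Prod>e\<in>C. \<tau> e) = 1)"
    using balanced_iff_cut[OF simple conn \<tau>_pm1] by simp
  also have "\<dots> \<longleftrightarrow> (\<forall>C\<in>cycles \<Gamma>. cycle_sign \<Gamma> (map_cycle f C) =
      (if odd (card C) then - cycle_sign \<Gamma> C else cycle_sign \<Gamma> C))"
  proof (rule ball_cong[OF refl])
    fix C assume C: "C \<in> cycles \<Gamma>"
    show "(\<Prod>e\<in>C. \<tau> e) = 1 \<longleftrightarrow> cycle_sign \<Gamma> (map_cycle f C) =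
        (if odd (card C) then - cycle_sign \<Gamma> C else cycle_sign \<Gamma> C)"
      using cycle_sign_pm1[OF sg C] prod[OF C]
        cycle_sign_pm1[OF sg map_cycle_in_cycles[OF simple aut C]] by auto
  qed
  also have "\<dots> \<longleftrightarrow> weak_automorphism \<Gamma> f"
    using aut by (auto simp: weak_automorphism_def odd_cycles_def even_cycles_def)
  finally show ?thesis .
qed

section \<open>Weak automorphisms through images of classes of cycles\<close>

lemma sign_condition_iff_image:
  fixes s :: "'b \<Rightarrow> int"
  assumes bij: "bij_betw g X X" and s: "\<And>x. x \<in> X \<Longrightarrow> s x \<in> {1, -1}" and c: "c \<in> {1, -1}"
  shows "(\<forall>x\<in>X. s (g x) = c * s x) \<longleftrightarrow> g ` {x \<in> X. s x = 1} = {x \<in> X. s x = c}"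
proof
  assume L: "\<forall>x\<in>X. s (g x) = c * s x"
  have X: "g ` X = X" using bij by (simp add: bij_betw_def)
  show "g ` {x \<in> X. s x = 1} = {x \<in> X. s x = c}"
  proof (intro equalityI subsetI)
    fix y assume y: "y \<in> {x \<in> X. s x = c}"
    then obtain x where "x \<in> X" "y = g x" using X by blast
    with y L c show "y \<in> g ` {x \<in> X. s x = 1}" by auto
  qed (use L X in auto)
next
  assume R: "g ` {x \<in> X. s x = 1} = {x \<in> X. s x = c}"
  have inj: "inj_on g X" and X: "g ` X = X" using bij by (simp_all add: bij_betw_def)
  show "\<forall>x\<in>X. s (g x) = c * s x"
  proof
    fix x assume x: "x \<in> X"
    then have gx: "g x \<in> X" using X by blast
    \<comment> \<open>Injectivity of \<open>g\<close> lets membership be pulled back to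
      \<open>x\<close>. With only two possible values, knowing when \<open>s (g x)\<close> equals
      \<open>c\<close> determines it.\<close>
    have "s (g x) = c \<longleftrightarrow> g x \<in> g ` {x \<in> X. s x = 1}"
      using gx R by simp
    also have "\<dots> \<longleftrightarrow> s x = 1"
      using inj x by (auto dest: inj_onD)
    finally show "s (g x) = c * s x"
      using s[OF x] s[OF gx] c by auto
  qed
qed

text \<open>The two halves are \<open>sign_condition_iff_image\<close> with \<open>c = -1\<close> on
  odd cycles and with \<open>c = 1\<close> on even cycles; the classes with the opposite signs
  follow by complement.\<close>

lemma weak_automorphism_iff_images:
  assumes sg: "signed_graph \<Gamma>" and aut: "\<phi> \<in> Aut \<Gamma>"
  shows "weak_automorphism \<Gamma> \<phi> \<longleftrightarrow>
    map_cycle \<phi> ` pos_odd_cycles \<Gamma> = neg_odd_cycles \<Gamma> \<and>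
    map_cycle \<phi> ` pos_even_cycles \<Gamma> = pos_even_cycles \<Gamma>"
proof -
  have simple: "simple_graph \<Gamma>"
    using sg by (simp add: signed_graph_def)
  have s: "cycle_sign \<Gamma> C \<in> {1, -1}" if "C \<in> odd_cycles \<Gamma> \<or> C \<in> even_cycles \<Gamma>" for C
    using that cycle_sign_pm1[OF sg] by (auto simp: odd_cycles_def even_cycles_def)
  have "(\<forall>C\<in>odd_cycles \<Gamma>. cycle_sign \<Gamma> (map_cycle \<phi> C) = - cycle_sign \<Gamma> C) \<longleftrightarrow>
      map_cycle \<phi> ` pos_odd_cycles \<Gamma> = neg_odd_cycles \<Gamma>"
    using sign_condition_iff_image[OF map_cycle_bij(1)[OF simple aut], of "cycle_sign \<Gamma>" "-1"] s
    by (simp add: pos_odd_cycles_def neg_odd_cycles_def)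
  moreover have "(\<forall>C\<in>even_cycles \<Gamma>. cycle_sign \<Gamma> (map_cycle \<phi> C) = cycle_sign \<Gamma> C) \<longleftrightarrow>
      map_cycle \<phi> ` pos_even_cycles \<Gamma> = pos_even_cycles \<Gamma>"
    using sign_condition_iff_image[OF map_cycle_bij(2)[OF simple aut], of "cycle_sign \<Gamma>" 1] s
    by (simp add: pos_even_cycles_def)
  ultimately show ?thesis
    using aut by (simp add: weak_automorphism_def)
qed

theorem theorem3p2:
  fixes \<Gamma> :: "'a sgraph"
  assumes "signed_graph \<Gamma>"
  shows "(sign_symmetric \<Gamma> \<longleftrightarrow> (\<exists>\<phi>. weak_automorphism \<Gamma> \<phi>)) \<and>
    ((\<exists>\<phi>. weak_automorphism \<Gamma> \<phi>) \<longleftrightarrow>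
     (\<exists>\<phi>\<in>Aut \<Gamma>. map_cycle \<phi> ` pos_odd_cycles \<Gamma> = neg_odd_cycles \<Gamma> \<and>
                map_cycle \<phi> ` pos_even_cycles \<Gamma> = pos_even_cycles \<Gamma>))"
proof
  have "verts (negation \<Gamma>) = verts \<Gamma>"
    by (simp add: negation_def)
  then show "sign_symmetric \<Gamma> \<longleftrightarrow> (\<exists>\<phi>. weak_automorphism \<Gamma> \<phi>)"
    using switching_iso_iff_weak_automorphism[OF assms]
    unfolding sign_symmetric_def switching_isomorphic_def by metis
  show "(\<exists>\<phi>. weak_automorphism \<Gamma> \<phi>) \<longleftrightarrow>
     (\<exists>\<phi>\<in>Aut \<Gamma>. map_cycle \<phi> ` pos_odd_cycles \<Gamma> = neg_odd_cycles \<Gamma> \<and>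
                map_cycle \<phi> ` pos_even_cycles \<Gamma> = pos_even_cycles \<Gamma>)"
    using weak_automorphism_iff_images[OF assms] weak_automorphism_def by metis
qed

end
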